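(* Let $k<n$ be natural numbers and let $X\in\triangle_n$. Then $|\triangle_k(X)|={n \brack k}$.
   Context: $\mathbb{N}=\{1,2,3,\dots\}$ and $T_n=n(n+1)/2$ is the $n$-th triangular number, $T_0=0$. A finite set $X\subseteq\mathbb{N}$ is triangular if $|X|=T_n$ for some $n$; writing $X=\{x_1<x_2<\dots<x_{T_n}\}$, the $i$-th level of $X$ ($1\le i\le n$) is $\{x_{T_{i-1}+1},\dots,x_{T_i}\}$ (so it has $i$ elements). $\triangle_n$ denotes the set of all $X\subseteq\mathbb{N}$ with $|X|=T_n$ (triangular sets with $n$ levels). For triangular sets $X,Y$, $X\le Y$ means $X\subseteq Y$ and every level of $X$ is contained in a single level of $Y$, distinct levels of $X$ being contained in distinct levels of $Y$. For $X$ triangular, $\triangle_k(X)=\{Y\in\triangle_k: Y\le X\}$. The numbers ${n\brack k}$ are defined by ${n\brack 0}=1$, ${n\brack n}=1$, and ${n\brack k}={n-1\brack k}+\binom{n}{k}{n-1\brack k-1}$ for $0<k<n$. *)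

theory Defs
  imports Complex_Main "HOL-Library.Nat_Bijection"
begin

text \<open>
  The triangular number \<open>T\<^sub>n = n (n + 1) / 2\<close> is \<^const>\<open>triangle\<close>. Ground sets consist of
  positive integers, hence the condition \<open>0 \<notin> X\<close>.
\<close>

definition triangular_sets :: "nat \<Rightarrow> nat set set" where
  "triangular_sets n = {X. finite X \<and> 0 \<notin> X \<and> card X = triangle n}"

text \<open>
  Levels are numbered from 1, whereas \<open>sorted_list_of_set X\<close> is indexed from 0: the element
  \<open>x\<^sub>j\<close> of \<open>X = {x\<^sub>1 < x\<^sub>2 < \<dots>}\<close> is entry \<open>j - 1\<close>. The index \<open>i\<close> is meant to range over
  \<open>{1..n}\<close> for \<open>X \<in> triangular_sets n\<close>.
\<close>

definition level :: "nat set \<Rightarrow> nat \<Rightarrow> nat set" where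
  "level X i = {sorted_list_of_set X ! (j - 1) | j. j \<in> {triangle (i - 1) + 1..triangle i}}"

definition tri_le :: "nat set \<Rightarrow> nat set \<Rightarrow> bool" where
  "tri_le X Y \<longleftrightarrow>
     (\<exists>m n. X \<in> triangular_sets m \<and> Y \<in> triangular_sets n \<and> X \<subseteq> Y \<and>
       (\<exists>f. inj_on f {1..m} \<and>
            (\<forall>i\<in>{1..m}. f i \<in> {1..n} \<and> level X i \<subseteq> level Y (f i))))"

definition triangular_subsets :: "nat \<Rightarrow> nat set \<Rightarrow> nat set set" where
  "triangular_subsets k X = {Y \<in> triangular_sets k. tri_le Y X}"

text \<open>The value 0 for \<open>k > n\<close> is a convention; the recursion never reaches that case from \<open>k \<le> n\<close>.\<close>

fun tri_binomial :: "nat \<Rightarrow> nat \<Rightarrow> nat" where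
  "tri_binomial n k =
     (if k = 0 \<or> k = n then 1
      else if k < n then tri_binomial (n - 1) k + (n choose k) * tri_binomial (n - 1) (k - 1)
      else 0)"

declare tri_binomial.simps [simp del]

end

theory Submission imports Defs begin

text \<open>
  Split off the last level \<open>L\<close> of \<open>X\<close>, leaving \<open>X'\<close> with one level fewer. As the elements of \<open>L\<close>
  exceed those of \<open>X'\<close>, a level of \<open>Y \<le> X\<close> contained in \<open>L\<close> can only be the last level of \<open>Y\<close>.
  So either \<open>Y \<le> X'\<close>, or \<open>Y\<close> arises from some \<open>Z \<le> X'\<close> with one level fewer by adding an arbitrary
  subset of \<open>L\<close> of the right size. Counting both kinds yields the recursion of the numbers.
\<close>

section \<open>Recursion of the numbers, and growth of the triangular numbers\<close>

lemma tri_binomial_0 [simp]: "tri_binomial n 0 = 1"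
  by (subst tri_binomial.simps) simp

lemma tri_binomial_0_Suc [simp]: "tri_binomial 0 (Suc k) = 0"
  by (subst tri_binomial.simps) simp

lemma tri_binomial_self [simp]: "tri_binomial n n = 1"
  by (subst tri_binomial.simps) simp

lemma tri_binomial_gt: "n < k \<Longrightarrow> tri_binomial n k = 0"
  by (subst tri_binomial.simps) simp

text \<open>The convention of value 0 above the diagonal frees the recursion from side conditions:
  for \<open>k = n\<close> the first summand vanishes and the second is 1, and for
  \<open>k > n\<close> every term is 0.\<close>

lemma tri_binomial_Suc_Suc:
  "tri_binomial (Suc n) (Suc k) =
     tri_binomial n (Suc k) + (Suc n choose Suc k) * tri_binomial n k"
proof (cases k n rule: linorder_cases)
  case less
  then show ?thesis by (subst tri_binomial.simps) simp
qed (simp_all add: tri_binomial_gt)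

lemma mono_triangle: "i \<le> j \<Longrightarrow> triangle i \<le> triangle j"
  by (induction rule: dec_induct) simp_all

lemma triangle_less_Suc: "triangle n < triangle (Suc n)"
  by simp

lemma triangle_inject [simp]: "triangle i = triangle j \<longleftrightarrow> i = j"
  using strict_mono_eq[of triangle] triangle_less_Suc strict_mono_Suc_iff by blast

section \<open>Sorted enumerations and nonempty levels\<close>

lemma sorted_list_of_set_Un_less:
  fixes A B :: "'a :: linorder set"
  assumes "finite A" "finite B" "\<And>a b. a \<in> A \<Longrightarrow> b \<in> B \<Longrightarrow> a < b"
  shows "sorted_list_of_set (A \<union> B) = sorted_list_of_set A @ sorted_list_of_set B"
\<comment> \<open>A strictly sorted list is determined by its set of entries.\<close>
proof (rule strict_sorted_equal)
  show "sorted_wrt (<) (sorted_list_of_set A @ sorted_list_of_set B)"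
    using assms by (simp add: sorted_wrt_append)
qed (use assms in simp_all)

text \<open>Only the index interval matters: it contains \<open>triangle i\<close> once
  \<open>i \<ge> 1\<close>, and \<open>!\<close> denotes some number even past the end of the list,
  so \<open>X\<close> is arbitrary. For \<open>i = 0\<close> the interval is empty.\<close>

lemma level_nonempty: "1 \<le> i \<Longrightarrow> level X i \<noteq> {}"
  by (cases i) (auto simp: level_def)

section \<open>Triangular sets and their last level\<close>

lemma triangular_setsD:
  assumes "X \<in> triangular_sets n"
  shows "finite X" "0 \<notin> X" "card X = triangle n"
  using assms by (simp_all add: triangular_sets_def)

text \<open>Identifies the level counts that \<open>tri_le\<close> quantifies existentially.\<close>

lemma triangular_sets_unique:
  assumes "X \<in> triangular_sets m" "X \<in> triangular_sets n"
  shows "m = n"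
  using assms by (simp add: triangular_sets_def)

lemma triangular_sets_0 [simp]: "triangular_sets 0 = {{}}"
  by (auto simp: triangular_sets_def)

text \<open>Describes a last level by order and size, so that no list indices appear in the counting
  argument. It serves both for the ambient set and for its triangular subsets.\<close>

definition level_extension :: "nat \<Rightarrow> nat set \<Rightarrow> nat set \<Rightarrow> bool" where
  "level_extension n X L \<longleftrightarrow> X \<in> triangular_sets n \<and> finite L \<and> 0 \<notin> L \<and> card L = Suc n \<and>
     (\<forall>x\<in>X. \<forall>y\<in>L. x < y)"

lemma level_extensionD:
  assumes "level_extension n X L"
  shows "X \<in> triangular_sets n" "finite X" "finite L" "card L = Suc n"
    and "\<And>x y. x \<in> X \<Longrightarrow> y \<in> L \<Longrightarrow> x < y" "X \<inter> L = {}"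
  using assms by (auto simp: level_extension_def triangular_sets_def)

lemma level_extension_Un:
  assumes "level_extension n X L"
  shows "X \<union> L \<in> triangular_sets (Suc n)"
  using assms level_extensionD(6)[OF assms]
  by (simp add: level_extension_def triangular_sets_def card_Un_disjoint)

text \<open>Cut the increasing enumeration after \<open>triangle n\<close> entries;
  \<open>Suc n\<close> entries remain.\<close>

lemma triangular_sets_Suc_cases:
  assumes "X \<in> triangular_sets (Suc n)"
  obtains X' L where "X = X' \<union> L" "level_extension n X' L"
proof
  let ?xs = "sorted_list_of_set X"
  let ?A = "set (take (triangle n) ?xs)" and ?B = "set (drop (triangle n) ?xs)"
  note X = triangular_setsD[OF assms]
  show XAB: "X = ?A \<union> ?B"
    using X(1) by (metis append_take_drop_id set_append set_sorted_list_of_set)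
  have "sorted_wrt (<) (take (triangle n) ?xs @ drop (triangle n) ?xs)"
    by simp
  then have "\<forall>x\<in>?A. \<forall>y\<in>?B. x < y"
    unfolding sorted_wrt_append by blast
  moreover have "card ?A = triangle n" "card ?B = Suc n"
    using X by (simp_all add: distinct_card)
  ultimately show "level_extension n ?A ?B"
    using XAB X(2) unfolding level_extension_def triangular_sets_def by blast
qed

context
  fixes n X L
  assumes ext: "level_extension n X L"
begin

lemma sorted_list_of_set_extension:
  "sorted_list_of_set (X \<union> L) = sorted_list_of_set X @ sorted_list_of_set L"
  using level_extensionD[OF ext] by (intro sorted_list_of_set_Un_less) auto

lemma level_extension_old:
  assumes "i \<in> {1..n}"
  shows "level (X \<union> L) i = level X i"
proof -
  \<comment> \<open>With \<open>j\<close> in the range of level \<open>i\<close>, the 0-based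
    position \<open>j - 1\<close> is below \<open>triangle i\<close>, so it falls into the first of
    the two concatenated lists.\<close>
  have "triangle i \<le> card X"
    using assms mono_triangle triangular_setsD(3)[OF level_extensionD(1)[OF ext]] by simp
  then have "sorted_list_of_set (X \<union> L) ! (j - 1) = sorted_list_of_set X ! (j - 1)"
    if "j \<in> {triangle (i - 1) + 1..triangle i}" for j
    using that by (auto simp: sorted_list_of_set_extension nth_append)
  then show ?thesis
    unfolding level_def by (intro Collect_cong ex_cong1) auto
qed

lemma level_extension_new: "level (X \<union> L) (Suc n) = L"
proof -
  have len: "length (sorted_list_of_set X) = triangle n"
    using triangular_setsD(3)[OF level_extensionD(1)[OF ext]] by simp
  have "L = set (sorted_list_of_set L)"
    using level_extensionD(3)[OF ext] by simp
  also have "\<dots> = (\<lambda>i. sorted_list_of_set L ! i) ` {0..<Suc n}"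
    using level_extensionD(4)[OF ext]
    by (simp add: set_conv_nth image_def) (metis atLeast0LessThan lessThan_iff)
  also have "\<dots> = (\<lambda>i. sorted_list_of_set (X \<union> L) ! (triangle n + i)) ` {0..<Suc n}"
    using len by (simp add: sorted_list_of_set_extension nth_append)
  \<comment> \<open>Passage to the 1-based numbering of \<open>level\<close>: with
    \<open>j = i + (triangle n + 1)\<close>, the position \<open>triangle n + i\<close> is
    \<open>j - 1\<close>.\<close>
  also have "\<dots> = (\<lambda>j. sorted_list_of_set (X \<union> L) ! (j - 1)) ` (\<lambda>i. i + (triangle n + 1)) ` {0..<Suc n}"
    by (simp add: image_image add.commute)
  also have "(\<lambda>i. i + (triangle n + 1)) ` {0..<Suc n} = {triangle n + 1..triangle (Suc n)}"
    unfolding image_add_atLeastLessThan' by auto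
  also have "(\<lambda>j. sorted_list_of_set (X \<union> L) ! (j - 1)) ` \<dots> = level (X \<union> L) (Suc n)"
    unfolding level_def diff_Suc_1 by (rule Setcompr_eq_image[symmetric])
  finally show ?thesis ..
qed

end

section \<open>Levels cover the set; membership in \<open>triangular_subsets\<close>\<close>

lemma Union_levels: "X \<in> triangular_sets n \<Longrightarrow> (\<Union>i\<in>{1..n}. level X i) = X"
proof (induction n arbitrary: X)
  case (Suc n)
  then obtain X' L where X: "X = X' \<union> L" and ext: "level_extension n X' L"
    by (auto elim: triangular_sets_Suc_cases)
  have "(\<Union>i\<in>{1..Suc n}. level X i) = (\<Union>i\<in>{1..n}. level X i) \<union> level X (Suc n)"
    by (auto simp: atLeastAtMostSuc_conv)
  also have "\<dots> = (\<Union>i\<in>{1..n}. level X' i) \<union> L"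
    by (simp add: X level_extension_old[OF ext] level_extension_new[OF ext])
  finally show ?case
    using Suc.IH level_extensionD(1)[OF ext] X by simp
qed simp

lemma level_subset: "X \<in> triangular_sets n \<Longrightarrow> i \<in> {1..n} \<Longrightarrow> level X i \<subseteq> X"
  using Union_levels by blast

text \<open>The inclusion demanded by \<open>tri_le\<close> follows from that of the levels, because
  the levels of \<open>Y\<close> cover \<open>Y\<close>; the level counts are forced by
  cardinality.\<close>

lemma mem_triangular_subsets_iff:
  assumes X: "X \<in> triangular_sets n"
  shows "Y \<in> triangular_subsets k X \<longleftrightarrow> Y \<in> triangular_sets k \<and>
    (\<exists>f. inj_on f {1..k} \<and> (\<forall>i\<in>{1..k}. f i \<in> {1..n} \<and> level Y i \<subseteq> level X (f i)))"
    (is "_ \<longleftrightarrow> _ \<and> (\<exists>f. ?P f)")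
proof
  assume "Y \<in> triangular_subsets k X"
  then obtain m n' f where "Y \<in> triangular_sets k" "Y \<in> triangular_sets m" "X \<in> triangular_sets n'"
    "inj_on f {1..m}" "\<forall>i\<in>{1..m}. f i \<in> {1..n'} \<and> level Y i \<subseteq> level X (f i)"
    unfolding triangular_subsets_def tri_le_def by blast
  moreover from this have "m = k" "n' = n"
    using X triangular_sets_unique by blast+
  ultimately show "Y \<in> triangular_sets k \<and> (\<exists>f. ?P f)"
    by blast
next
  assume *: "Y \<in> triangular_sets k \<and> (\<exists>f. ?P f)"
  then obtain f where f: "?P f"
    by blast
  then have "level Y i \<subseteq> X" if "i \<in> {1..k}" for i
    using that level_subset[OF X] by blast
  then have "Y \<subseteq> X"
    using * Union_levels[of Y k] by blast
  then show "Y \<in> triangular_subsets k X"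
    using * X unfolding triangular_subsets_def tri_le_def by blast
qed

lemma triangular_subsetsI:
  assumes "X \<in> triangular_sets n" "Y \<in> triangular_sets k" "inj_on f {1..k}"
    and "\<And>i. i \<in> {1..k} \<Longrightarrow> f i \<in> {1..n} \<and> level Y i \<subseteq> level X (f i)"
  shows "Y \<in> triangular_subsets k X"
  unfolding mem_triangular_subsets_iff[OF assms(1)] using assms(2-4) by blast

lemma triangular_subsets_subset: "Y \<in> triangular_subsets k X \<Longrightarrow> Y \<subseteq> X"
  by (auto simp: triangular_subsets_def tri_le_def)

lemma finite_triangular_subsets: "finite X \<Longrightarrow> finite (triangular_subsets k X)"
  by (rule finite_subset[of _ "Pow X"]) (auto dest: triangular_subsets_subset)

lemma triangular_subsets_0:
  assumes "X \<in> triangular_sets n"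
  shows "triangular_subsets 0 X = {{}}"
  by (auto simp: mem_triangular_subsets_iff[OF assms])

lemma triangular_subsets_empty_Suc: "triangular_subsets (Suc k) {} = {}"
proof -
  have False if "Y \<in> triangular_subsets (Suc k) {}" for Y
    using that triangular_subsets_subset[OF that]
    by (simp add: triangular_subsets_def triangular_sets_def)
  then show ?thesis by blast
qed

section \<open>The recursion for triangular subsets and their number\<close>

lemma triangular_subsets_extension:
  assumes ext: "level_extension n X L"
  shows "triangular_subsets (Suc k) (X \<union> L) = triangular_subsets (Suc k) X \<union>
    (\<lambda>(Z, M). Z \<union> M) ` (triangular_subsets k X \<times> {M. M \<subseteq> L \<and> card M = Suc k})"
    (is "_ = _ \<union> ?R")
proof (intro Set.set_eqI iffI)
  note X = level_extensionD(1)[OF ext] and less = level_extensionD(5)[OF ext]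
  note XL = level_extension_Un[OF ext]
  note old = level_extension_old[OF ext] and new = level_extension_new[OF ext]
  fix Y
  {
    assume "Y \<in> triangular_subsets (Suc k) (X \<union> L)"
    then obtain f where Y: "Y \<in> triangular_sets (Suc k)" and inj: "inj_on f {1..Suc k}"
      and f: "\<And>i. i \<in> {1..Suc k} \<Longrightarrow> f i \<in> {1..Suc n}"
      and lev: "\<And>i. i \<in> {1..Suc k} \<Longrightarrow> level Y i \<subseteq> level (X \<union> L) (f i)"
      unfolding mem_triangular_subsets_iff[OF XL] by blast
    obtain Z M where YZM: "Y = Z \<union> M" and extY: "level_extension k Z M"
      using Y triangular_sets_Suc_cases by blast
    note oldY = level_extension_old[OF extY, folded YZM]
      and newY = level_extension_new[OF extY, folded YZM]
    have lev': "f i \<in> {1..n} \<and> level Y i \<subseteq> level X (f i)"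
      if "i \<in> {1..Suc k}" "f i \<noteq> Suc n" for i
    proof -
      have "f i \<in> {1..n}" using f[OF that(1)] that(2) by auto
      then show ?thesis using lev[OF that(1)] old by simp
    qed
    show "Y \<in> triangular_subsets (Suc k) X \<union> ?R"
    \<comment> \<open>The index \<open>Suc n\<close> stands for \<open>L\<close>. If the last level
      \<open>M\<close> of \<open>Y\<close> goes there, injectivity keeps the other levels inside
      \<open>X\<close>; otherwise no level goes there.\<close>
    proof (cases "f (Suc k) = Suc n")
      case True
      have "f i \<in> {1..n} \<and> level Z i \<subseteq> level X (f i)" if i: "i \<in> {1..k}" for i
      proof -
        have "f i \<noteq> Suc n"
          using i True inj_onD[OF inj, of i "Suc k"] by auto
        then show ?thesis
          using lev'[of i] oldY[OF i] i by simp
      qed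
      moreover have "inj_on f {1..k}"
        using inj by (rule inj_on_subset) auto
      ultimately have "Z \<in> triangular_subsets k X"
        by (intro triangular_subsetsI[OF X level_extensionD(1)[OF extY]])
      moreover have "M \<subseteq> L"
        using lev[of "Suc k"] True newY new by simp
      ultimately show ?thesis
        using level_extensionD(4)[OF extY] YZM by blast
    next
      case False
      then have "M \<subseteq> level X (f (Suc k))" "f (Suc k) \<in> {1..n}"
        using lev'[of "Suc k"] newY by auto
      then have MX: "M \<subseteq> X"
        using level_subset[OF X] by blast
      \<comment> \<open>An earlier level inside \<open>L\<close> would have an element
        \<open>y\<close> above every \<open>z\<close> in \<open>M\<close>, as \<open>M\<close> lies
        in \<open>X\<close>; but \<open>y\<close> is in \<open>Z\<close>, which lies below
        \<open>M\<close>.\<close>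
      have "f i \<noteq> Suc n" if i: "i \<in> {1..Suc k}" for i
      proof
        assume fi: "f i = Suc n"
        then have ik: "i \<in> {1..k}" using False i by (cases "i = Suc k") auto
        obtain y where y: "y \<in> level Z i"
          using level_nonempty[of i Z] ik by auto
        then have "y \<in> L"
          using lev[OF i] fi oldY[OF ik] new by auto
        moreover have "y \<in> Z"
          using y level_subset[OF level_extensionD(1)[OF extY] ik] by blast
        moreover obtain z where "z \<in> M"
          using level_extensionD(4)[OF extY] by fastforce
        ultimately show False
          using MX less[of z y] level_extensionD(5)[OF extY, of y z] by force
      qed
      then have "Y \<in> triangular_subsets (Suc k) X"
        using lev' by (intro triangular_subsetsI[OF X Y inj]) blast
      then show ?thesis ..
    qed
  }
  {
    assume "Y \<in> triangular_subsets (Suc k) X \<union> ?R"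
    then show "Y \<in> triangular_subsets (Suc k) (X \<union> L)"
    proof
      assume "Y \<in> triangular_subsets (Suc k) X"
      then obtain f where Y: "Y \<in> triangular_sets (Suc k)" and inj: "inj_on f {1..Suc k}"
        and f: "\<And>i. i \<in> {1..Suc k} \<Longrightarrow> f i \<in> {1..n}"
        and lev: "\<And>i. i \<in> {1..Suc k} \<Longrightarrow> level Y i \<subseteq> level X (f i)"
        unfolding mem_triangular_subsets_iff[OF X] by blast
      have "f i \<in> {1..Suc n} \<and> level Y i \<subseteq> level (X \<union> L) (f i)" if "i \<in> {1..Suc k}" for i
        using f[OF that] lev[OF that] old[OF f[OF that]] by simp
      then show ?thesis
        by (rule triangular_subsetsI[OF XL Y inj])
    next
      assume "Y \<in> ?R"
      then obtain Z M where Y: "Y = Z \<union> M" and Z: "Z \<in> triangular_subsets k X"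
        and M: "M \<subseteq> L" "card M = Suc k"
        by auto
      from Z obtain f where Zk: "Z \<in> triangular_sets k" and inj: "inj_on f {1..k}"
        and f: "\<And>i. i \<in> {1..k} \<Longrightarrow> f i \<in> {1..n}"
        and lev: "\<And>i. i \<in> {1..k} \<Longrightarrow> level Z i \<subseteq> level X (f i)"
        unfolding mem_triangular_subsets_iff[OF X] by blast
      have extY: "level_extension k Z M"
        using Zk M triangular_subsets_subset[OF Z] ext finite_subset[OF M(1)]
        unfolding level_extension_def by blast
      \<comment> \<open>The new last level \<open>M\<close> is sent to \<open>L\<close>; the value
        \<open>Suc n\<close> is fresh because \<open>f\<close> maps into
        \<open>{1..n}\<close>.\<close>
      let ?f = "f(Suc k := Suc n)"
      have new_notin: "Suc n \<notin> f ` {1..k}"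
        using f by fastforce
      have "?f ` {1..k} = f ` {1..k}"
        by (intro image_cong) simp_all
      moreover have "{1..Suc k} = insert (Suc k) {1..k}" "{1..k} - {Suc k} = {1..k}"
        by auto
      ultimately have inj': "inj_on ?f {1..Suc k}"
        using inj_on_fun_updI[OF inj new_notin, of "Suc k"] new_notin
        by (simp only: inj_on_insert fun_upd_same) simp
      have "?f i \<in> {1..Suc n} \<and> level Y i \<subseteq> level (X \<union> L) (?f i)" if i: "i \<in> {1..Suc k}" for i
      proof (cases "i = Suc k")
        case True
        then show ?thesis
          using M level_extension_new[OF extY] new by (simp add: Y)
      next
        case False
        then have ik: "i \<in> {1..k}" using i by auto
        have "?f i = f i" using False by simp
        then show ?thesis
          using f[OF ik] lev[OF ik] old[OF f[OF ik]] level_extension_old[OF extY ik]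
          by (simp add: Y)
      qed
      then show ?thesis
        using triangular_subsetsI[OF XL _ inj'] level_extension_Un[OF extY] Y by simp
    qed
  }
qed

lemma card_triangular_subsets_extension:
  assumes ext: "level_extension n X L"
  shows "card (triangular_subsets (Suc k) (X \<union> L)) =
    card (triangular_subsets (Suc k) X) + (Suc n choose Suc k) * card (triangular_subsets k X)"
proof -
  let ?P = "triangular_subsets k X \<times> {M. M \<subseteq> L \<and> card M = Suc k}"
  let ?R = "(\<lambda>(Z, M). Z \<union> M) ` ?P"
  note E = level_extensionD[OF ext]
  have "inj_on (\<lambda>(Z, M). Z \<union> M) ?P"
  \<comment> \<open>As \<open>X\<close> and \<open>L\<close> are disjoint, intersecting the union
    with each of them recovers the pair.\<close>
  proof (rule inj_on_inverseI[where g = "\<lambda>Y. (Y \<inter> X, Y \<inter> L)"])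
    fix p assume "p \<in> ?P"
    then obtain Z M where p: "p = (Z, M)" and "Z \<in> triangular_subsets k X" and "M \<subseteq> L"
      by auto
    then have "(Z \<union> M) \<inter> X = Z" "(Z \<union> M) \<inter> L = M"
      using triangular_subsets_subset[of Z k X] E(6) by auto
    then show "((case p of (Z, M) \<Rightarrow> Z \<union> M) \<inter> X, (case p of (Z, M) \<Rightarrow> Z \<union> M) \<inter> L) = p"
      by (simp add: p)
  qed
  then have "card ?R = card ?P"
    by (rule card_image)
  also have "\<dots> = (Suc n choose Suc k) * card (triangular_subsets k X)"
    using n_subsets[OF E(3), of "Suc k"] E(4) by (simp add: card_cartesian_product mult.commute)
  finally have "card ?R = (Suc n choose Suc k) * card (triangular_subsets k X)" .
  moreover have "triangular_subsets (Suc k) X \<inter> ?R = {}"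
  proof -
    \<comment> \<open>The nonempty part \<open>M\<close> of \<open>Y\<close> lies in
      \<open>L\<close>, whereas \<open>Y\<close> is a subset of \<open>X\<close>.\<close>
    have False if "Y \<in> triangular_subsets (Suc k) X" "Y \<in> ?R" for Y
    proof -
      from that(2) obtain Z M where Y: "Y = Z \<union> M" and M: "M \<subseteq> L" "card M = Suc k"
        by auto
      from M(2) have "M \<noteq> {}"
        by auto
      then show False
        using triangular_subsets_subset[OF that(1)] Y M(1) E(6) by blast
    qed
    then show ?thesis
      by blast
  qed
  moreover have "finite ?P"
    using finite_triangular_subsets[OF E(2)] E(3) by simp
  ultimately show ?thesis
    unfolding triangular_subsets_extension[OF ext]
    using finite_triangular_subsets[OF E(2)] by (simp add: card_Un_disjoint)
qed

text \<open>Here \<open>k\<close> is arbitrary because the step for \<open>Suc l\<close> calls the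
  hypothesis at both \<open>Suc l\<close> and \<open>l\<close>, and \<open>Suc l\<close> may exceed
  \<open>n\<close>; both sides are then 0.\<close>

lemma card_triangular_subsets:
  "X \<in> triangular_sets n \<Longrightarrow> card (triangular_subsets k X) = tri_binomial n k"
proof (induction n arbitrary: X k)
  case 0
  then show ?case
    by (cases k) (simp_all add: triangular_subsets_0[of _ 0] triangular_subsets_empty_Suc)
next
  case (Suc n)
  show ?case
  proof (cases k)
    case 0
    then show ?thesis
      by (simp add: triangular_subsets_0[OF Suc.prems])
  next
    case (Suc l)
    obtain X' L where "X = X' \<union> L" and ext: "level_extension n X' L"
      using Suc.prems triangular_sets_Suc_cases by blast
    then show ?thesis
      using card_triangular_subsets_extension[OF ext] Suc.IH[OF level_extensionD(1)[OF ext]]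
      by (simp add: \<open>k = Suc l\<close> tri_binomial_Suc_Suc)
  qed
qed

theorem theorem1:
  fixes k n :: nat and X :: "nat set"
  assumes "k < n"
    and "X \<in> triangular_sets n"
  shows "card (triangular_subsets k X) = tri_binomial n k"
  using assms(2) by (rule card_triangular_subsets)

end
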